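(* Let $(u_t^{(j)},t\ge0)_{j=1,\dots,J}$ be the solution of the TEKI flow $$\frac{\mathrm du_t^{(j)}}{\mathrm dt}=C^{u,G}(u_t)\Gamma^{-1}(y-G(u_t^{(j)}))-C(u_t)C_0^{-1}u_t^{(j)},\qquad j=1,\dots,J,$$ initialized by a linearly independent ensemble $(u_0^{(j)})_{j=1,\dots,J}$ in $\mathbb R^{n_x}$. Then the mapping $V_e:\mathbb R_+\to\mathbb R_+$, $V_e(t)=\frac1J\sum_{j=1}^J\|e_t^{(j)}\|^2$ with $e_t^{(j)}=u_t^{(j)}-\bar u_t$, is bounded for all $t\ge0$ by $$V_e(t)\le\frac{1}{\frac{2\sigma_{\min}}{J}t+V_e(0)^{-1}},$$ where $\sigma_{\min}$ denotes the smallest eigenvalue of $C_0^{-1}$.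
   Context: Let $n_x,K,J\in\mathbb N$ with $J\ge2$, let $y\in\mathbb R^K$ be fixed, let $G:\mathbb R^{n_x}\to\mathbb R^K$, and let $\Gamma\in\mathbb R^{K\times K}$, $C_0\in\mathbb R^{n_x\times n_x}$ be symmetric positive definite. $\|\cdot\|$ is the Euclidean norm. For an ensemble $u=(u^{(j)})_{j=1,\dots,J}$ in $\mathbb R^{n_x}$ put $\bar u=\frac1J\sum_{j}u^{(j)}$, $\bar G=\frac1J\sum_jG(u^{(j)})$, $C(u)=\frac1J\sum_j(u^{(j)}-\bar u)(u^{(j)}-\bar u)^\top$ and $C^{u,G}(u)=\frac1J\sum_j(u^{(j)}-\bar u)(G(u^{(j)})-\bar G)^\top$. *)

theory Defs
  imports "HOL-Analysis.Analysis"
begin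

definition sym_pos_def :: "real^'n^'n \<Rightarrow> bool" where
  "sym_pos_def A \<longleftrightarrow> transpose A = A \<and> (\<forall>x. x \<noteq> 0 \<longrightarrow> 0 < x \<bullet> (A *v x))"

definition eigenvalues :: "real^'n^'n \<Rightarrow> real set" where
  "eigenvalues A = {l. \<exists>v. v \<noteq> 0 \<and> A *v v = l *\<^sub>R v}"

(* The real spectrum is finite, and nonempty when A is symmetric; Min is meant only for such A. *)
definition smallest_eigenvalue :: "real^'n^'n \<Rightarrow> real" where
  "smallest_eigenvalue A = Min (eigenvalues A)"

(* The rank-one matrix x y^T. *)
definition outer :: "real^'n \<Rightarrow> real^'m \<Rightarrow> real^'m^'n" where
  "outer x y = (\<chi> i j. x $ i * y $ j)"

(* An ensemble of size J is a function u on the particle indices {1..J}; values of u at other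
   indices are never used. *)

definition ens_mean :: "nat \<Rightarrow> (nat \<Rightarrow> 'a::real_vector) \<Rightarrow> 'a" where
  "ens_mean J u = (1 / real J) *\<^sub>R (\<Sum>j = 1..J. u j)"

definition ens_cross_cov ::
    "nat \<Rightarrow> (nat \<Rightarrow> real^'n) \<Rightarrow> (nat \<Rightarrow> real^'m) \<Rightarrow> real^'m^'n" where
  "ens_cross_cov J u w =
     (1 / real J) *\<^sub>R (\<Sum>j = 1..J. outer (u j - ens_mean J u) (w j - ens_mean J w))"

definition ens_cov :: "nat \<Rightarrow> (nat \<Rightarrow> real^'n) \<Rightarrow> real^'n^'n" where
  "ens_cov J u = ens_cross_cov J u u"

definition lin_indep_ensemble :: "nat \<Rightarrow> (nat \<Rightarrow> 'a::real_vector) \<Rightarrow> bool" where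
  "lin_indep_ensemble J u \<longleftrightarrow> inj_on u {1..J} \<and> independent (u ` {1..J})"

definition teki_rhs ::
    "nat \<Rightarrow> (real^'n \<Rightarrow> real^'k) \<Rightarrow> real^'k \<Rightarrow> real^'k^'k \<Rightarrow> real^'n^'n
      \<Rightarrow> (nat \<Rightarrow> real^'n) \<Rightarrow> nat \<Rightarrow> real^'n" where
  "teki_rhs J G y \<Gamma> C0 u j =
     ens_cross_cov J u (\<lambda>i. G (u i)) *v (matrix_inv \<Gamma> *v (y - G (u j)))
     - ens_cov J u *v (matrix_inv C0 *v u j)"

(* Classical solution on [0, \<infinity>); the derivative at t = 0 is one-sided. *)
definition teki_solution ::
    "nat \<Rightarrow> (real^'n \<Rightarrow> real^'k) \<Rightarrow> real^'k \<Rightarrow> real^'k^'k \<Rightarrow> real^'n^'n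
      \<Rightarrow> (real \<Rightarrow> nat \<Rightarrow> real^'n) \<Rightarrow> bool" where
  "teki_solution J G y \<Gamma> C0 u \<longleftrightarrow>
     (\<forall>t\<ge>0. \<forall>j\<in>{1..J}.
        ((\<lambda>s. u s j) has_vector_derivative teki_rhs J G y \<Gamma> C0 (u t) j) (at t within {0..}))"

definition ens_spread :: "nat \<Rightarrow> (nat \<Rightarrow> 'a::real_normed_vector) \<Rightarrow> real" where
  "ens_spread J u = (1 / real J) * (\<Sum>j = 1..J. (norm (u j - ens_mean J u))\<^sup>2)"

end

theory Submission
  imports Defs
begin

text \<open>
  Write \<open>e\<^sub>j = u\<^sub>j - ens_mean J u\<close> and \<open>g\<^sub>j = G (u\<^sub>j) - ens_mean J (G \<circ> u)\<close>. Since the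
  deviations \<open>e\<^sub>j\<close> sum to zero, constants drop out of \<open>\<Sum>j. e\<^sub>j \<bullet> L (g\<^sub>j + c)\<close> for linear \<open>L\<close>, and
  the derivative of the spread along the flow is
  \<open>V' = - (2/J) (\<Sum>j. e\<^sub>j \<bullet> C\<^sup>u\<^sup>G \<Gamma>\<inverse> g\<^sub>j) - (2/J) (\<Sum>j. e\<^sub>j \<bullet> C C\<^sub>0\<inverse> e\<^sub>j)\<close>.

  Both sums are of the form \<open>J tr (M B M\<^sup>T)\<close> with \<open>M\<close> an empirical covariance and \<open>B\<close> positive
  definite (lemma \<open>sum_inner_outer_sum\<close>). The first is therefore nonnegative, whatever \<open>G\<close> is. The
  second is at least \<open>J \<sigma>\<close> times the squared Frobenius norm of \<open>C\<close>, which by the Gram identity is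
  \<open>(1/J\<^sup>2) (\<Sum>i j. (e\<^sub>i \<bullet> e\<^sub>j)\<^sup>2)\<close>. Keeping only the diagonal terms and applying the Cauchy-Schwarz
  inequality bounds this norm below by \<open>V\<^sup>2 / J\<close>. Hence \<open>V' \<le> - (2 \<sigma> / J) V\<^sup>2\<close>
  (lemma \<open>teki_dissipation\<close>), and comparison with the Riccati equation, that is, the
  mean value theorem for \<open>1 / V\<close>, gives the bound. The members of a linearly independent ensemble are
  distinct, so that \<open>V 0 > 0\<close>.

  The inequality \<open>\<sigma> (x \<bullet> x) \<le> x \<bullet> B x\<close> for the smallest eigenvalue \<open>\<sigma>\<close> of a symmetric \<open>B\<close> holds
  because a minimiser of the quadratic form on the unit sphere is an eigenvector.
\<close>

section \<open>The smallest eigenvalue of a symmetric matrix\<close>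

lemma inner_symmetric_matrix:
  fixes A :: "real^'n^'n"
  assumes "transpose A = A"
  shows "x \<bullet> (A *v y) = (A *v x) \<bullet> y"
  by (metis assms dot_lmul_matrix vector_transpose_matrix)

text \<open>Eigenvectors to distinct eigenvalues are orthogonal, hence linearly independent.\<close>

lemma finite_eigenvalues_symmetric:
  fixes A :: "real^'n^'n"
  assumes sym: "transpose A = A"
  shows "finite (eigenvalues A)"
proof -
  have "\<forall>l\<in>eigenvalues A. \<exists>v. v \<noteq> 0 \<and> A *v v = l *\<^sub>R v"
    by (auto simp: eigenvalues_def)
  then obtain v where v: "\<And>l. l \<in> eigenvalues A \<Longrightarrow> v l \<noteq> 0 \<and> A *v v l = l *\<^sub>R v l"
    by metis
  have orth: "v l \<bullet> v m = 0" if "l \<in> eigenvalues A" "m \<in> eigenvalues A" "l \<noteq> m" for l m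
  proof -
    have "v l \<bullet> (A *v v m) = (A *v v l) \<bullet> v m"
      by (rule inner_symmetric_matrix[OF sym])
    then have "m * (v l \<bullet> v m) = l * (v l \<bullet> v m)"
      using v that by simp
    then show ?thesis using that by simp
  qed
  have inj: "inj_on v (eigenvalues A)"
    using orth v by (metis inj_onI inner_eq_zero_iff)
  have "pairwise orthogonal (v ` eigenvalues A)"
    using orth by (auto simp: pairwise_def orthogonal_def)
  moreover have "0 \<notin> v ` eigenvalues A" using v by force
  ultimately have "finite (v ` eigenvalues A)"
    by (intro independent_imp_finite pairwise_orthogonal_independent)
  then show ?thesis using inj by (rule finite_imageD)
qed

text \<open>A vector on which a positive semidefinite form vanishes lies in the kernel.\<close>

lemma psd_form_zero_imp_kernel:
  fixes A :: "real^'n^'n"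
  assumes sym: "transpose A = A" and psd: "\<And>x. 0 \<le> x \<bullet> (A *v x)"
    and zero: "x \<bullet> (A *v x) = 0"
  shows "A *v x = 0"
proof -
  define w where "w = A *v x"
  define q where "q = w \<bullet> (A *v w)"
  have q: "0 \<le> q" unfolding q_def by (rule psd)
  have cross: "x \<bullet> (A *v w) = w \<bullet> w"
    using inner_symmetric_matrix[OF sym] by (simp add: w_def)
  have quad: "0 \<le> 2 * t * (w \<bullet> w) + t\<^sup>2 * q" for t
  proof -
    have "(x + t *\<^sub>R w) \<bullet> (A *v (x + t *\<^sub>R w))
        = x \<bullet> (A *v x) + t * (x \<bullet> (A *v w)) + t * (w \<bullet> w) + t\<^sup>2 * q"
      by (simp add: matrix_vector_right_distrib matrix_vector_mult_scaleR inner_left_distrib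
          inner_right_distrib q_def power2_eq_square distrib_left mult.assoc flip: w_def)
    then show ?thesis
      using psd[of "x + t *\<^sub>R w"] zero cross by simp
  qed
  \<comment> \<open>The quadratic is negative for small negative \<open>t\<close> unless \<open>w = 0\<close>; taking
    \<open>t = - (w \<bullet> w) / (1 + q)\<close> also covers the case \<open>q = 0\<close>.\<close>
  have "0 \<le> - 2 * (w \<bullet> w) * (w \<bullet> w) / (1 + q) + (w \<bullet> w)\<^sup>2 * (q / (1 + q)\<^sup>2)"
    using quad[of "- (w \<bullet> w) / (1 + q)"] by (simp add: power_divide field_simps)
  moreover have "q / (1 + q)\<^sup>2 \<le> 1 / (1 + q)"
    using q by (simp add: divide_simps power2_eq_square)
  then have "(w \<bullet> w)\<^sup>2 * (q / (1 + q)\<^sup>2) \<le> (w \<bullet> w)\<^sup>2 * (1 / (1 + q))"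
    by (rule mult_left_mono) simp
  ultimately have "(w \<bullet> w)\<^sup>2 / (1 + q) \<le> 0"
    by (simp add: power2_eq_square)
  then have "(w \<bullet> w)\<^sup>2 \<le> 0" using q by (simp add: divide_le_0_iff)
  then show ?thesis by (simp add: w_def)
qed

text \<open>The minimum of the quadratic form on the unit sphere is attained, at an eigenvector.\<close>

lemma rayleigh_minimum_eigenvalue:
  fixes A :: "real^'n^'n"
  assumes sym: "transpose A = A"
  obtains m where "m \<in> eigenvalues A" "\<And>x. m * (x \<bullet> x) \<le> x \<bullet> (A *v x)"
proof -
  have "\<exists>v\<in>sphere (0::real^'n) 1. \<forall>z\<in>sphere 0 1. v \<bullet> (A *v v) \<le> z \<bullet> (A *v z)"
    by (rule continuous_attains_inf) (auto intro!: continuous_intros matrix_vector_mult_linear_continuous_on)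
  then obtain v :: "real^'n" where v: "norm v = 1"
    and vmin: "\<And>z. norm z = 1 \<Longrightarrow> v \<bullet> (A *v v) \<le> z \<bullet> (A *v z)" by auto
  define m where "m = v \<bullet> (A *v v)"
  have low: "m * (x \<bullet> x) \<le> x \<bullet> (A *v x)" for x
  proof (cases "x = 0")
    case False
    have "m \<le> (x /\<^sub>R norm x) \<bullet> (A *v (x /\<^sub>R norm x))"
      unfolding m_def by (rule vmin) (use False in simp)
    also have "\<dots> = (x \<bullet> (A *v x)) / (x \<bullet> x)"
      using False by (simp add: matrix_vector_mult_scaleR dot_square_norm power2_eq_square field_simps)
    finally show ?thesis using False by (simp add: field_simps)
  qed simp
  define S where "S = A - m *\<^sub>R mat 1"
  have S: "S *v x = A *v x - m *\<^sub>R x" for x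
    by (simp add: S_def matrix_vector_mult_diff_rdistrib flip: scaleR_matrix_vector_assoc)
  have "transpose S = S"
    using sym by (auto simp: S_def transpose_def vec_eq_iff mat_def)
  then have "S *v v = 0"
    by (rule psd_form_zero_imp_kernel)
      (use low v in \<open>simp_all add: S inner_diff_right m_def dot_square_norm\<close>)
  then have "m \<in> eigenvalues A"
    using v by (auto simp: eigenvalues_def S intro!: exI[of _ v])
  then show thesis using low that by blast
qed

lemma smallest_eigenvalue_in_eigenvalues:
  fixes A :: "real^'n^'n"
  assumes "transpose A = A"
  shows "smallest_eigenvalue A \<in> eigenvalues A"
  unfolding smallest_eigenvalue_def
  using finite_eigenvalues_symmetric[OF assms] rayleigh_minimum_eigenvalue[OF assms]
  by (metis Min_in empty_iff)

lemma smallest_eigenvalue_le_form: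
  fixes A :: "real^'n^'n"
  assumes "transpose A = A"
  shows "smallest_eigenvalue A * (x \<bullet> x) \<le> x \<bullet> (A *v x)"
proof -
  obtain m where m: "m \<in> eigenvalues A" "\<And>x. m * (x \<bullet> x) \<le> x \<bullet> (A *v x)"
    using rayleigh_minimum_eigenvalue[OF assms] by blast
  have "smallest_eigenvalue A \<le> m"
    unfolding smallest_eigenvalue_def
    using finite_eigenvalues_symmetric[OF assms] m by simp
  then have "smallest_eigenvalue A * (x \<bullet> x) \<le> m * (x \<bullet> x)"
    by (simp add: mult_right_mono)
  with m(2)[of x] show ?thesis by linarith
qed

lemma smallest_eigenvalue_pos:
  fixes A :: "real^'n^'n"
  assumes "sym_pos_def A"
  shows "0 < smallest_eigenvalue A"
proof -
  have "smallest_eigenvalue A \<in> eigenvalues A"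
    using assms by (simp add: sym_pos_def_def smallest_eigenvalue_in_eigenvalues)
  then obtain v where "v \<noteq> 0" "A *v v = smallest_eigenvalue A *\<^sub>R v"
    by (auto simp: eigenvalues_def)
  moreover from this have "0 < v \<bullet> (A *v v)" using assms unfolding sym_pos_def_def by blast
  ultimately have "0 < smallest_eigenvalue A * (v \<bullet> v)" "0 < v \<bullet> v" by simp_all
  then show ?thesis by (rule zero_less_mult_pos2)
qed

lemma sym_pos_def_matrix_inv:
  fixes A :: "real^'n^'n"
  assumes "sym_pos_def A"
  shows "sym_pos_def (matrix_inv A)"
proof -
  have sym: "transpose A = A" and pos: "\<And>x. x \<noteq> 0 \<Longrightarrow> 0 < x \<bullet> (A *v x)"
    using assms by (auto simp: sym_pos_def_def)
  have "x = 0" if "A *v x = 0" for x using pos[of x] that by fastforce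
  then have "invertible A"
    by (metis invertible_left_inverse matrix_left_invertible_ker)
  then have right: "A ** matrix_inv A = mat 1" and left: "matrix_inv A ** A = mat 1"
    unfolding invertible_def matrix_inv_def by (metis (mono_tags, lifting) someI_ex)+
  have cancel: "A *v (matrix_inv A *v x) = x" for x
    by (simp add: matrix_vector_mul_assoc right)
  have "transpose (matrix_inv A) = matrix_inv A"
    by (metis left right sym matrix_mul_assoc matrix_mul_lid matrix_mul_rid matrix_transpose_mul
        transpose_mat)
  moreover have "0 < x \<bullet> (matrix_inv A *v x)" if "x \<noteq> 0" for x
  proof -
    have "matrix_inv A *v x \<noteq> 0" using cancel[of x] that by auto
    from pos[OF this] show ?thesis by (simp add: cancel inner_commute)
  qed
  ultimately show ?thesis by (simp add: sym_pos_def_def)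
qed

section \<open>Quadratic identities for sums of rank-one matrices\<close>

lemma outer_sum_mult_vec: "(\<Sum>i\<in>I. outer (e i) (g i)) *v w = (\<Sum>i\<in>I. (g i \<bullet> w) *\<^sub>R e i)"
proof -
  have "outer x z *v w = (z \<bullet> w) *\<^sub>R x" for x :: "real^'a" and z
    by (simp add: outer_def matrix_vector_mult_def vec_eq_iff inner_vec_def sum_distrib_left mult_ac)
  then show ?thesis
    by (induction I rule: infinite_finite_induct) (simp_all add: matrix_vector_mult_add_rdistrib)
qed

lemma outer_sum_row: "(\<Sum>i\<in>I. outer (e i) (g i)) $ a = (\<Sum>i\<in>I. (e i $ a) *\<^sub>R g i)"
  by (simp add: outer_def vec_eq_iff)

text \<open>The trace of \<open>M B M\<^sup>T\<close> for \<open>M = \<Sum>i. e\<^sub>i g\<^sub>i\<^sup>T\<close>, written as the sum of the form \<open>B\<close> over the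
  rows of \<open>M\<close>. For \<open>B = mat 1\<close> it is the squared Frobenius norm of \<open>M\<close>.\<close>

lemma trace_form_outer_sum:
  fixes I :: "'i set" and e :: "'i \<Rightarrow> real^'n" and g :: "'i \<Rightarrow> real^'m" and B :: "real^'m^'m"
  defines "M \<equiv> \<Sum>i\<in>I. outer (e i) (g i)"
  shows "(\<Sum>a\<in>UNIV. (M $ a) \<bullet> (B *v (M $ a)))
    = (\<Sum>i\<in>I. \<Sum>j\<in>I. (e i \<bullet> e j) * (g i \<bullet> (B *v g j)))"
proof -
  have "(M $ a) \<bullet> (B *v (M $ a))
      = (\<Sum>j\<in>I. \<Sum>i\<in>I. (e i $ a * e j $ a) * (g i \<bullet> (B *v g j)))" for a
    unfolding M_def outer_sum_row
    by (simp add: matrix_vector_mult_scaleR inner_sum_left inner_sum_right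
        linear_sum[OF matrix_vector_mul_linear] sum_distrib_left mult_ac del: sum_component)
  also have "(\<Sum>j\<in>I. \<Sum>i\<in>I. (e i $ a * e j $ a) * (g i \<bullet> (B *v g j)))
      = (\<Sum>i\<in>I. \<Sum>j\<in>I. (e i $ a * e j $ a) * (g i \<bullet> (B *v g j)))" for a
    by (rule sum.swap)
  finally have "(\<Sum>a\<in>UNIV. (M $ a) \<bullet> (B *v (M $ a)))
      = (\<Sum>a\<in>UNIV. \<Sum>i\<in>I. \<Sum>j\<in>I. (e i $ a * e j $ a) * (g i \<bullet> (B *v g j)))" by simp
  also have "\<dots> = (\<Sum>i\<in>I. \<Sum>a\<in>UNIV. \<Sum>j\<in>I. (e i $ a * e j $ a) * (g i \<bullet> (B *v g j)))"
    by (rule sum.swap)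
  also have "\<dots> = (\<Sum>i\<in>I. \<Sum>j\<in>I. \<Sum>a\<in>UNIV. (e i $ a * e j $ a) * (g i \<bullet> (B *v g j)))"
    by (intro sum.cong refl sum.swap)
  finally show ?thesis by (simp add: inner_vec_def[of "e _"] sum_distrib_right)
qed

text \<open>With \<open>M = \<Sum>i. e\<^sub>i g\<^sub>i\<^sup>T\<close> the identity reads \<open>\<Sum>j. e\<^sub>j\<^sup>T M B g\<^sub>j = tr (M B M\<^sup>T)\<close>,
  which is nonnegative when \<open>B\<close> is positive semidefinite.\<close>

lemma sum_inner_outer_sum:
  fixes I :: "'i set" and e :: "'i \<Rightarrow> real^'n" and g :: "'i \<Rightarrow> real^'m" and B :: "real^'m^'m"
  defines "M \<equiv> \<Sum>i\<in>I. outer (e i) (g i)"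
  shows "(\<Sum>j\<in>I. e j \<bullet> (M *v (B *v g j))) = (\<Sum>a\<in>UNIV. (M $ a) \<bullet> (B *v (M $ a)))"
proof -
  have "(\<Sum>j\<in>I. e j \<bullet> (M *v (B *v g j)))
      = (\<Sum>j\<in>I. \<Sum>i\<in>I. (e i \<bullet> e j) * (g i \<bullet> (B *v g j)))"
    by (simp add: M_def outer_sum_mult_vec inner_sum_right inner_commute mult_ac)
  also have "\<dots> = (\<Sum>i\<in>I. \<Sum>j\<in>I. (e i \<bullet> e j) * (g i \<bullet> (B *v g j)))"
    by (rule sum.swap)
  finally show ?thesis unfolding M_def trace_form_outer_sum .
qed

text \<open>The squared Frobenius norm of \<open>\<Sum>i. e\<^sub>i e\<^sub>i\<^sup>T\<close> is that of the Gram matrix \<open>e\<^sub>i \<bullet> e\<^sub>j\<close>, whose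
  diagonal alone gives this lower bound, by the Cauchy-Schwarz inequality.\<close>

lemma frobenius_outer_sum_lower_bound:
  fixes I :: "'i set" and e :: "'i \<Rightarrow> real^'n"
  assumes "finite I"
  defines "M \<equiv> \<Sum>i\<in>I. outer (e i) (e i)"
  shows "(\<Sum>i\<in>I. (norm (e i))\<^sup>2)\<^sup>2 \<le> real (card I) * (\<Sum>a\<in>UNIV. (M $ a) \<bullet> (M $ a))"
proof -
  have "(\<Sum>i\<in>I. (norm (e i))\<^sup>2)\<^sup>2 \<le> (\<Sum>i\<in>I. ((norm (e i))\<^sup>2)\<^sup>2) * real (card I)"
    using Cauchy_Schwarz_ineq_sum[of "\<lambda>i. (norm (e i))\<^sup>2" "\<lambda>_. 1" I] by simp
  also have "(\<Sum>i\<in>I. ((norm (e i))\<^sup>2)\<^sup>2) \<le> (\<Sum>i\<in>I. \<Sum>j\<in>I. (e i \<bullet> e j)\<^sup>2)"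
  proof (rule sum_mono)
    fix i assume "i \<in> I"
    then have "(e i \<bullet> e i)\<^sup>2 \<le> (\<Sum>j\<in>I. (e i \<bullet> e j)\<^sup>2)"
      using assms by (intro member_le_sum) auto
    then show "((norm (e i))\<^sup>2)\<^sup>2 \<le> (\<Sum>j\<in>I. (e i \<bullet> e j)\<^sup>2)" by (simp add: dot_square_norm)
  qed
  also have "(\<Sum>i\<in>I. \<Sum>j\<in>I. (e i \<bullet> e j)\<^sup>2) = (\<Sum>a\<in>UNIV. (M $ a) \<bullet> (M $ a))"
    using trace_form_outer_sum[of e e I "mat 1"] unfolding M_def by (simp add: power2_eq_square)
  finally show ?thesis by (simp add: mult.commute mult_right_mono)
qed

section \<open>Dissipation of the ensemble spread\<close>

lemma sum_deviation_eq_0: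
  assumes "J \<noteq> 0"
  shows "(\<Sum>j = 1..J. u j - ens_mean J u) = 0"
  using assms by (simp add: sum_subtractf ens_mean_def sum_constant_scaleR)

lemma sum_inner_linear_shift:
  fixes e :: "'i \<Rightarrow> 'a::real_inner" and L :: "'b::real_vector \<Rightarrow> 'a"
  assumes "(\<Sum>j\<in>I. e j) = 0" "linear L"
  shows "(\<Sum>j\<in>I. e j \<bullet> L (w j - c)) = (\<Sum>j\<in>I. e j \<bullet> L (w j))"
proof -
  have "(\<Sum>j\<in>I. e j \<bullet> L (w j - c)) = (\<Sum>j\<in>I. e j \<bullet> L (w j)) - (\<Sum>j\<in>I. e j) \<bullet> L c"
    using assms(2) by (simp add: linear_diff inner_diff_right sum_subtractf inner_sum_left)
  then show ?thesis using assms(1) by simp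
qed

text \<open>The moving mean contributes nothing to the derivative, as the deviations sum to zero.\<close>

lemma ens_spread_has_real_derivative:
  fixes u :: "real \<Rightarrow> nat \<Rightarrow> 'a::real_inner"
  assumes "J \<noteq> 0"
    and d: "\<And>j. j \<in> {1..J} \<Longrightarrow> ((\<lambda>s. u s j) has_vector_derivative d j) (at t within S)"
  shows "((\<lambda>s. ens_spread J (u s)) has_real_derivative
     2 / real J * (\<Sum>j = 1..J. (u t j - ens_mean J (u t)) \<bullet> d j)) (at t within S)"
proof -
  let ?e = "\<lambda>s j. u s j - ens_mean J (u s)"
  have e: "((\<lambda>s. ?e s j) has_vector_derivative d j - ens_mean J d) (at t within S)"
    if "j \<in> {1..J}" for j
    unfolding ens_mean_def using that
    by (intro derivative_intros d bounded_linear.has_vector_derivative[OF bounded_linear_scaleR_right]) auto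
  have sq: "((\<lambda>s. (norm (?e s j))\<^sup>2) has_real_derivative 2 * (?e t j \<bullet> (d j - ens_mean J d)))
      (at t within S)" if "j \<in> {1..J}" for j
  proof -
    have "((\<lambda>s. ?e s j \<bullet> ?e s j) has_vector_derivative
        ?e t j \<bullet> (d j - ens_mean J d) + (d j - ens_mean J d) \<bullet> ?e t j) (at t within S)"
      by (rule bounded_bilinear.has_vector_derivative[OF bounded_bilinear_inner e[OF that] e[OF that]])
    then show ?thesis
      by (simp add: has_real_derivative_iff_has_vector_derivative dot_square_norm inner_commute)
  qed
  have "((\<lambda>s. ens_spread J (u s)) has_real_derivative
      1 / real J * (\<Sum>j = 1..J. 2 * (?e t j \<bullet> (d j - ens_mean J d)))) (at t within S)"
    unfolding ens_spread_def by (intro DERIV_cmult DERIV_sum sq)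
  moreover have "(\<Sum>j = 1..J. ?e t j \<bullet> (d j - ens_mean J d)) = (\<Sum>j = 1..J. ?e t j \<bullet> d j)"
    by (rule sum_inner_linear_shift[of "?e t" "{1..J}" "\<lambda>x. x"])
      (rule sum_deviation_eq_0[OF assms(1)], rule linear_ident)
  ultimately show ?thesis by (simp flip: sum_distrib_left)
qed

lemma linear_matrix_vector_mul2: "linear (\<lambda>x::real^'c. P *v (Q *v x))"
  using linear_compose[OF matrix_vector_mul_linear[of Q] matrix_vector_mul_linear[of P]]
  by (simp add: o_def)

text \<open>The left-hand side is the derivative of the spread along the flow, by the preceding
  derivative formula. The data term can only decrease it; the regularisation term gives the
  quadratic rate.\<close>

lemma teki_dissipation:
  fixes G :: "real^'n \<Rightarrow> real^'k" and u :: "nat \<Rightarrow> real^'n"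
  assumes J: "J \<noteq> 0" and \<Gamma>: "sym_pos_def \<Gamma>" and C0: "sym_pos_def C0"
  shows "2 / real J * (\<Sum>j = 1..J. (u j - ens_mean J u) \<bullet> teki_rhs J G y \<Gamma> C0 u j)
    \<le> - (2 * smallest_eigenvalue (matrix_inv C0) / real J) * (ens_spread J u)\<^sup>2"
proof -
  define e where "e j = u j - ens_mean J u" for j
  define g where "g j = G (u j) - ens_mean J (\<lambda>i. G (u i))" for j
  define M where "M = (\<Sum>j = 1..J. outer (e j) (g j))"
  define N where "N = (\<Sum>j = 1..J. outer (e j) (e j))"
  define A where "A = matrix_inv \<Gamma>"
  define B where "B = matrix_inv C0"
  define \<sigma> where "\<sigma> = smallest_eigenvalue B"
  define F where "F = (\<Sum>a\<in>UNIV. (N $ a) \<bullet> (N $ a))"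
  have e0: "(\<Sum>j = 1..J. e j) = 0"
    unfolding e_def by (rule sum_deviation_eq_0[OF J])
  have A: "sym_pos_def A" and B: "sym_pos_def B"
    using \<Gamma> C0 by (simp_all add: A_def B_def sym_pos_def_matrix_inv)

  \<comment> \<open>\<open>G (u j) - y\<close> and \<open>g j\<close> differ by a constant, which the deviations annihilate; likewise
    \<open>u j\<close> and \<open>e j\<close> below.\<close>
  have "(\<Sum>j = 1..J. e j \<bullet> (M *v (A *v (G (u j) - y)))) = (\<Sum>j = 1..J. e j \<bullet> (M *v (A *v g j)))"
    unfolding g_def by (simp only: sum_inner_linear_shift[OF e0 linear_matrix_vector_mul2])
  also have "\<dots> = (\<Sum>a\<in>UNIV. (M $ a) \<bullet> (A *v (M $ a)))"
    unfolding M_def by (rule sum_inner_outer_sum)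
  also have "\<dots> \<ge> 0"
  proof (rule sum_nonneg)
    fix a show "0 \<le> (M $ a) \<bullet> (A *v (M $ a))"
      using A by (cases "M $ a = 0") (auto simp: sym_pos_def_def less_imp_le)
  qed
  finally have data: "0 \<le> (\<Sum>j = 1..J. e j \<bullet> (M *v (A *v (G (u j) - y))))" .

  have "(\<Sum>j = 1..J. e j \<bullet> (N *v (B *v u j))) = (\<Sum>j = 1..J. e j \<bullet> (N *v (B *v e j)))"
    using sum_inner_linear_shift[OF e0 linear_matrix_vector_mul2, of N B u "ens_mean J u"]
    by (simp add: e_def)
  also have "\<dots> = (\<Sum>a\<in>UNIV. (N $ a) \<bullet> (B *v (N $ a)))"
    unfolding N_def by (rule sum_inner_outer_sum)
  also have "\<dots> \<ge> \<sigma> * F"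
    unfolding F_def sum_distrib_left \<sigma>_def
    using B by (intro sum_mono smallest_eigenvalue_le_form) (simp add: sym_pos_def_def)
  finally have reg: "\<sigma> * F \<le> (\<Sum>j = 1..J. e j \<bullet> (N *v (B *v u j)))" .

  have "(real J * ens_spread J u)\<^sup>2 \<le> real J * F"
    using frobenius_outer_sum_lower_bound[of "{1..J}" e] J
    by (simp add: ens_spread_def F_def N_def e_def)
  then have "real J * (ens_spread J u)\<^sup>2 \<le> F"
    using J by (simp add: power_mult_distrib power2_eq_square mult.left_commute)
  then have spread: "\<sigma> * (real J * (ens_spread J u)\<^sup>2) \<le> \<sigma> * F"
    using smallest_eigenvalue_pos[OF B] by (simp add: \<sigma>_def)

  have cov: "ens_cross_cov J u (\<lambda>i. G (u i)) = (1 / real J) *\<^sub>R M" "ens_cov J u = (1 / real J) *\<^sub>R N"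
    by (simp_all add: ens_cov_def ens_cross_cov_def M_def N_def e_def g_def)
  have rhs: "teki_rhs J G y \<Gamma> C0 u j
      = - (1 / real J) *\<^sub>R (M *v (A *v (G (u j) - y)) + N *v (B *v u j))" for j
  proof -
    have "y - G (u j) = - (G (u j) - y)" by simp
    moreover have "P *v (Q *v - x) = - (P *v (Q *v x))" for P :: "real^'k^'n" and Q x
      using linear_neg[OF linear_matrix_vector_mul2] .
    ultimately have "M *v (A *v (y - G (u j))) = - (M *v (A *v (G (u j) - y)))" by metis
    then show ?thesis
      by (simp add: teki_rhs_def cov scaleR_add_right flip: scaleR_matrix_vector_assoc A_def B_def)
  qed
  have "(\<Sum>j = 1..J. e j \<bullet> teki_rhs J G y \<Gamma> C0 u j)
      = - (1 / real J) * ((\<Sum>j = 1..J. e j \<bullet> (M *v (A *v (G (u j) - y))))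
          + (\<Sum>j = 1..J. e j \<bullet> (N *v (B *v u j))))"
    by (simp only: rhs inner_scaleR_right inner_add_right sum.distrib flip: sum_distrib_left)
  also have "\<dots> \<le> - (1 / real J) * (\<sigma> * (real J * (ens_spread J u)\<^sup>2))"
    using data reg spread by (intro mult_left_mono_neg) auto
  also have "\<dots> = - \<sigma> * (ens_spread J u)\<^sup>2" using J by simp
  finally have "2 / real J * (\<Sum>j = 1..J. e j \<bullet> teki_rhs J G y \<Gamma> C0 u j)
      \<le> 2 / real J * (- \<sigma> * (ens_spread J u)\<^sup>2)"
    by (intro mult_left_mono) auto
  then show ?thesis by (simp add: e_def \<sigma>_def B_def)
qed

section \<open>Comparison with the Riccati equation\<close>

text \<open>The right-hand side solves \<open>W' = - c W\<^sup>2\<close> with \<open>W 0 = V 0\<close>. Since \<open>V\<close> is nonincreasing, \<open>V t > 0\<close>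
  forces \<open>V > 0\<close> on all of \<open>[0, t]\<close>, where \<open>1 / V\<close> then grows at rate at least \<open>c\<close>; if
  \<open>V t \<le> 0\<close>, the bound is trivial.\<close>

lemma riccati_comparison:
  fixes V V' :: "real \<Rightarrow> real"
  assumes deriv: "\<And>t. t \<ge> 0 \<Longrightarrow> (V has_real_derivative V' t) (at t within {0..})"
    and le: "\<And>t. t \<ge> 0 \<Longrightarrow> V' t \<le> - c * (V t)\<^sup>2"
    and "c \<ge> 0" "V 0 > 0" "t \<ge> 0"
  shows "V t \<le> 1 / (c * t + inverse (V 0))"
proof (cases "V t > 0")
  case False
  then show ?thesis using assms(3-5)
    by (smt (verit) divide_nonneg_nonneg mult_nonneg_nonneg positive_imp_inverse_positive)
next
  case True
  have sub: "{0..t} \<subseteq> {0..}" by auto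
  have der: "(V has_derivative (\<lambda>h. h * V' s)) (at s within {0..t})" if "s \<in> {0..t}" for s
    using DERIV_subset[OF deriv sub] that
    by (auto simp: has_field_derivative_def mult.commute[of _ "V' _"])
  have decr: "V' s \<le> 0" if "s \<ge> 0" for s
    using le[OF that] \<open>c \<ge> 0\<close> by (smt (verit) mult_nonneg_nonneg mult_minus_left zero_le_power2)
  have pos: "V s > 0" if s: "0 \<le> s" "s \<le> t" for s
  proof (cases "s = t")
    case False
    with s have "s < t" by simp
    have "\<exists>x\<in>{s<..<t}. V t - V s = (t - s) * V' x"
      by (rule mvt_simple[OF \<open>s < t\<close>]) (rule has_derivative_subset[OF der], use s in auto)
    then obtain x where "x \<in> {s<..<t}" "V t - V s = (t - s) * V' x" by blast
    moreover from this have "(t - s) * V' x \<le> 0"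
      using decr[of x] s \<open>s < t\<close> by (intro mult_nonneg_nonpos) auto
    ultimately show ?thesis using True by linarith
  qed (use True in simp)
  have "c * t + inverse (V 0) \<le> inverse (V t)"
  proof (cases "t = 0")
    case False
    with \<open>t \<ge> 0\<close> have "0 < t" by simp
    have "((\<lambda>s. inverse (V s)) has_derivative (\<lambda>h. - (inverse (V s) * (h * V' s) * inverse (V s))))
        (at s within {0..t})" if "0 \<le> s" "s \<le> t" for s
      using Deriv.has_derivative_inverse[OF _ der] pos[of s] that by auto
    from mvt_simple[OF \<open>0 < t\<close> this] obtain x where x: "x \<in> {0<..<t}"
      and mv: "inverse (V t) - inverse (V 0) = - (inverse (V x) * ((t - 0) * V' x) * inverse (V x))"
      by blast
    have "V x > 0" using pos[of x] x by simp
    have "c * (V x)\<^sup>2 \<le> - V' x" using le[of x] x by simp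
    then have "c \<le> - V' x / (V x)\<^sup>2"
      using \<open>V x > 0\<close> by (subst pos_le_divide_eq) simp_all
    then have "c * t \<le> (- V' x / (V x)\<^sup>2) * t"
      using \<open>t \<ge> 0\<close> by (rule mult_right_mono)
    also have "\<dots> = inverse (V t) - inverse (V 0)"
      unfolding mv by (simp add: field_simps power2_eq_square)
    finally show ?thesis by simp
  qed simp
  moreover have "0 < c * t + inverse (V 0)" using assms(3-5) by (simp add: add_nonneg_pos)
  ultimately show ?thesis using True
    by (metis inverse_eq_divide inverse_inverse_eq le_imp_inverse_le)
qed

lemma ens_spread_pos:
  assumes "2 \<le> J" "inj_on u {1..J}"
  shows "0 < ens_spread J u"
proof -
  have "u 1 \<noteq> u 2" using assms by (auto dest: inj_onD[of u _ 1 2])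
  then obtain k where k: "k \<in> {1..J}" "u k \<noteq> ens_mean J u"
    using assms(1) by (metis atLeastAtMost_iff le_refl one_le_numeral order_trans)
  have "0 < (\<Sum>j = 1..J. (norm (u j - ens_mean J u))\<^sup>2)"
    by (rule sum_pos2[OF _ k(1)]) (use k in auto)
  then show ?thesis using assms(1) by (simp add: ens_spread_def)
qed

theorem lemma4p3:
  fixes G :: "real^'n \<Rightarrow> real^'k"
    and y :: "real^'k"
    and \<Gamma> :: "real^'k^'k"
    and C0 :: "real^'n^'n"
    and J :: nat
    and u :: "real \<Rightarrow> nat \<Rightarrow> real^'n"
  defines "V\<^sub>e \<equiv> \<lambda>t. ens_spread J (u t)"
    and "\<sigma>_min \<equiv> smallest_eigenvalue (matrix_inv C0)"
  assumes "J \<ge> 2"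
    and "sym_pos_def \<Gamma>" and "sym_pos_def C0"
    and "teki_solution J G y \<Gamma> C0 u"
    and "lin_indep_ensemble J (u 0)"
  shows "\<forall>t\<ge>0. V\<^sub>e t \<le> 1 / (2 * \<sigma>_min / real J * t + inverse (V\<^sub>e 0))"
proof (intro allI impI)
  fix t :: real assume "0 \<le> t"
  let ?d = "\<lambda>s. 2 / real J * (\<Sum>j = 1..J. (u s j - ens_mean J (u s)) \<bullet> teki_rhs J G y \<Gamma> C0 (u s) j)"
  have J: "J \<noteq> 0" using \<open>J \<ge> 2\<close> by simp
  show "V\<^sub>e t \<le> 1 / (2 * \<sigma>_min / real J * t + inverse (V\<^sub>e 0))"
  proof (rule riccati_comparison[of _ ?d])
    show "(V\<^sub>e has_real_derivative ?d s) (at s within {0..})" if "s \<ge> 0" for s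
      unfolding V\<^sub>e_def using assms(6) that
      by (intro ens_spread_has_real_derivative[OF J]) (simp add: teki_solution_def)
    show "?d s \<le> - (2 * \<sigma>_min / real J) * (V\<^sub>e s)\<^sup>2" for s
      unfolding V\<^sub>e_def \<sigma>_min_def
      using \<open>sym_pos_def \<Gamma>\<close> \<open>sym_pos_def C0\<close> by (rule teki_dissipation[OF J])
    show "2 * \<sigma>_min / real J \<ge> 0"
      unfolding \<sigma>_min_def using smallest_eigenvalue_pos[OF sym_pos_def_matrix_inv[OF \<open>sym_pos_def C0\<close>]]
      by (simp add: less_imp_le)
    show "V\<^sub>e 0 > 0"
      unfolding V\<^sub>e_def using \<open>J \<ge> 2\<close> assms(7)
      by (intro ens_spread_pos) (simp_all add: lin_indep_ensemble_def)
  qed fact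
qed

end
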